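(* Let $k$ be a nonzero integer. (i) Let $n$ be an odd integer with $n>2$. If $k>2^{n}+2$, then the equation $x^{2}-kxy+y^{2}=-2^{n}$ has no solution in positive integers $x,y$. If $k\leq 2^{n}+2$ and the equation $x^{2}-kxy+y^{2}=-2^{n}$ has a solution in positive integers $x,y$, then $k$ is even. (ii) Let $n$ be a positive even integer. If $k>2^{n}+2$, then the equation $x^{2}-kxy+y^{2}=-2^{n}$ has no solution in positive odd integers $x,y$. If $k\leq 2^{n}+2$ and the equation $x^{2}-kxy+y^{2}=-2^{n}$ has a solution in positive odd integers $x,y$, then $k$ is even and $2$ divides $k$ exactly, i.e. $k\equiv 2 \pmod 4$.
   Context: Throughout, $k$ is an integer, and the paper assumes $k\neq 0$. *)

theory Defs
  imports "HOL-Number_Theory.Cong"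
begin

end

theory Submission imports Defs begin

text \<open>The bound on \<open>k\<close> is Vieta jumping: if \<open>y\<close> is the least entry of any positive solution, then
  \<open>x\<close> and the conjugate root \<open>k y - x\<close> are both at least \<open>y\<close>, and \<open>(x - y)(k y - x - y) \<ge> 0\<close>
  reads \<open>k y\<^sup>2 \<le> 2 y\<^sup>2 + N\<close>. For odd \<open>k\<close> the form \<open>x\<^sup>2 - k x y + y\<^sup>2\<close> is anisotropic
  modulo 2, so a solution for an odd exponent \<open>n\<close> descends to \<open>n - 2\<close> by halving, and for
  \<open>n = 1\<close> there is none. With \<open>x\<close>, \<open>y\<close> odd and \<open>4\<close> dividing \<open>2 ^ n\<close>, reduction modulo 4
  determines \<open>k\<close>.\<close>

lemma vieta_jumping_bound:
  fixes k N x y :: int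
  assumes "N > 0" "x > 0" "y > 0" "x\<^sup>2 - k * x * y + y\<^sup>2 = - N"
  shows "k \<le> N + 2"
proof -
  \<comment> \<open>\<open>P\<close> collects the entries of positive solutions, as naturals so that
    a least one exists. The equation is symmetric, so one coordinate suffices.\<close>
  define P where "P b \<longleftrightarrow> b > 0 \<and> (\<exists>a::int. a > 0 \<and> a\<^sup>2 - k * a * int b + (int b)\<^sup>2 = - N)"
    for b :: nat
  have "P (nat y)"
    unfolding P_def using assms by auto
  define b where "b = (LEAST b. P b)"
  have "P b"
    unfolding b_def using \<open>P (nat y)\<close> by (rule LeastI)
  then obtain a :: int where "b > 0" and "a > 0" and eq: "a\<^sup>2 - k * a * int b + (int b)\<^sup>2 = - N"
    unfolding P_def by blast
  \<comment> \<open>Swapping coordinates makes \<open>c\<close> an entry too, so the minimality of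
    \<open>b\<close> bounds every positive root of the quadratic.\<close>
  have min: "int b \<le> c" if "c > 0" "c\<^sup>2 - k * c * int b + (int b)\<^sup>2 = - N" for c
  proof -
    have "P (nat c)"
      unfolding P_def using that \<open>b > 0\<close>
      by (auto intro!: exI[of _ "int b"] simp: algebra_simps)
    then have "b \<le> nat c"
      unfolding b_def by (rule Least_le)
    with that(1) show ?thesis by simp
  qed
  \<comment> \<open>The other root of \<open>t\<^sup>2 - k * b * t + b\<^sup>2 + N\<close>: the
    roots have sum \<open>k * b\<close> and product \<open>b\<^sup>2 + N\<close>.\<close>
  define a' where "a' = k * int b - a"
  have "a * a' = (int b)\<^sup>2 + N"
    using eq by (simp add: a'_def algebra_simps power2_eq_square)
  moreover have "(int b)\<^sup>2 + N > 0"
    using \<open>N > 0\<close> by (simp add: add_nonneg_pos)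
  ultimately have "a' > 0"
    using \<open>a > 0\<close> by (metis zero_less_mult_pos)
  moreover have "a'\<^sup>2 - k * a' * int b + (int b)\<^sup>2 = - N"
    using eq by (simp add: a'_def algebra_simps power2_eq_square)
  ultimately have "int b \<le> a'" by (rule min)
  moreover have "int b \<le> a" using \<open>a > 0\<close> eq by (rule min)
  ultimately have "0 \<le> (a - int b) * (a' - int b)" by simp
  also have "\<dots> = N - (k - 2) * (int b)\<^sup>2"
    using eq by (simp add: a'_def algebra_simps power2_eq_square)
  finally have le: "(k - 2) * (int b)\<^sup>2 \<le> N" by simp
  show ?thesis
  proof (cases "k \<ge> 2")
    case True
    have "(k - 2) * 1 \<le> (k - 2) * (int b)\<^sup>2"
      using True \<open>b > 0\<close> by (intro mult_left_mono) auto
    with le show ?thesis by simp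
  qed (use \<open>N > 0\<close> in simp)
qed

lemma odd_middle_coefficient_unsolvable:
  fixes k x y :: int
  assumes "odd k"
  shows "x\<^sup>2 - k * x * y + y\<^sup>2 \<noteq> - (2 ^ (2 * m + 1))"
proof (induction m arbitrary: x y)
  case (0 x y)
  show ?case
  proof
    assume eq: "x\<^sup>2 - k * x * y + y\<^sup>2 = - (2 ^ (2 * 0 + 1))"
    then have "even (x\<^sup>2 - k * x * y + y\<^sup>2)" by simp
    \<comment> \<open>Modulo 2 the form is \<open>x\<^sup>2 + x * y + y\<^sup>2\<close>, which is
      odd unless both entries are even.\<close>
    with \<open>odd k\<close> have "even x" "even y" by auto
    then obtain u v where "x = 2 * u" "y = 2 * v" by (auto elim!: evenE)
    with eq have "2 * (u\<^sup>2 - k * u * v + v\<^sup>2) = - 1"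
      by (simp add: power2_eq_square algebra_simps)
    then show False by presburger
  qed
next
  case (Suc m x y)
  show ?case
  proof
    assume eq: "x\<^sup>2 - k * x * y + y\<^sup>2 = - (2 ^ (2 * Suc m + 1))"
    then have "even (x\<^sup>2 - k * x * y + y\<^sup>2)" by simp
    with \<open>odd k\<close> have "even x" "even y" by auto
    then obtain u v where "x = 2 * u" "y = 2 * v" by (auto elim!: evenE)
    \<comment> \<open>Halving both entries divides the form by 4, which lowers the exponent by
      2.\<close>
    with eq have "u\<^sup>2 - k * u * v + v\<^sup>2 = - (2 ^ (2 * m + 1))"
      by (simp add: power2_eq_square algebra_simps)
    with Suc.IH show False by blast
  qed
qed

lemma odd_solution_cong_2_mod_4:
  fixes k x y N :: int
  assumes "odd x" "odd y" "4 dvd N" "x\<^sup>2 - k * x * y + y\<^sup>2 = - N"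
  shows "[k = 2] (mod 4)"
proof -
  obtain u v w where "x = 2 * u + 1" "y = 2 * v + 1" "N = 4 * w"
    using assms(1-3) by (meson dvdE oddE)
  \<comment> \<open>Odd squares are 1 modulo 4, so \<open>k * x * y\<close> is 2 modulo 4; as
    \<open>x * y\<close> is odd, \<open>k\<close> has exactly one factor 2.\<close>
  with assms(4) have eq: "k * (2 * u + 1) * (2 * v + 1) = 4 * (u\<^sup>2 + u + v\<^sup>2 + v + w) + 2"
    by (simp add: power2_eq_square algebra_simps)
  then have "even (k * (2 * u + 1) * (2 * v + 1))" by simp
  then have "even k" by simp
  then obtain j where k: "k = 2 * j" by (elim evenE)
  with eq have "j * (2 * u + 1) * (2 * v + 1) = 2 * (u\<^sup>2 + u + v\<^sup>2 + v + w) + 1"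
    by (simp add: algebra_simps)
  then have "odd (j * (2 * u + 1) * (2 * v + 1))" by simp
  then have "odd j" by simp
  with k show ?thesis unfolding cong_iff_dvd_diff by presburger
qed

theorem theorem3p2:
  fixes k :: int
  assumes "k \<noteq> 0"
  shows
    "(\<forall>n::nat. odd n \<and> n > 2 \<longrightarrow>
        (k > 2 ^ n + 2 \<longrightarrow>
          \<not> (\<exists>x y :: int. x > 0 \<and> y > 0 \<and> x\<^sup>2 - k * x * y + y\<^sup>2 = - (2 ^ n))) \<and>
        (k \<le> 2 ^ n + 2 \<and>
          (\<exists>x y :: int. x > 0 \<and> y > 0 \<and> x\<^sup>2 - k * x * y + y\<^sup>2 = - (2 ^ n)) \<longrightarrow>
          even k)) \<and>
     (\<forall>n::nat. even n \<and> n > 0 \<longrightarrow>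
        (k > 2 ^ n + 2 \<longrightarrow>
          \<not> (\<exists>x y :: int. x > 0 \<and> y > 0 \<and> odd x \<and> odd y \<and>
                x\<^sup>2 - k * x * y + y\<^sup>2 = - (2 ^ n))) \<and>
        (k \<le> 2 ^ n + 2 \<and>
          (\<exists>x y :: int. x > 0 \<and> y > 0 \<and> odd x \<and> odd y \<and>
                x\<^sup>2 - k * x * y + y\<^sup>2 = - (2 ^ n)) \<longrightarrow>
          even k \<and> [k = 2] (mod 4)))"
proof (intro conjI allI impI notI; elim conjE exE)
  fix n x y
  assume "x > 0" "y > 0" "x\<^sup>2 - k * x * y + y\<^sup>2 = - (2 ^ n)" "k > 2 ^ n + 2"
  then show False using vieta_jumping_bound[of "2 ^ n" x y k] by simp
next
  fix n :: nat and x y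
  assume "odd n" "x\<^sup>2 - k * x * y + y\<^sup>2 = - (2 ^ n)"
  then show "even k" using odd_middle_coefficient_unsolvable[of k x y] by (metis oddE)
next
  fix n x y
  assume "x > 0" "y > 0" "x\<^sup>2 - k * x * y + y\<^sup>2 = - (2 ^ n)" "k > 2 ^ n + 2"
  then show False using vieta_jumping_bound[of "2 ^ n" x y k] by simp
next
  fix n :: nat and x y
  assume *: "even n" "n > 0" "odd x" "odd y" "x\<^sup>2 - k * x * y + y\<^sup>2 = - (2 ^ n)"
  \<comment> \<open>A positive even \<open>n\<close> is at least 2.\<close>
  then have "(2::int) ^ 2 dvd 2 ^ n" by (intro le_imp_power_dvd) presburger
  with * show "[k = 2] (mod 4)" using odd_solution_cong_2_mod_4[of x y "2 ^ n" k] by simp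
  then show "even k" unfolding cong_iff_dvd_diff by presburger
qed

end
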